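(* There is an absolute constant $C>0$ such that the following holds. Fix $j\in\mathbb N$ and write $\phi=\phi_j$, $\lambda=\lambda_j$. For all $x\in(0,1]$ such that $\phi'(x)$ exists, $$|x\phi'(x)|\le C\,|\lambda|^3(\log|\lambda|)^2.$$
   Context: Let $K:[0,1]\times[0,1]\to\mathbb R$ be defined by $K(x,y)=\frac12-\{(xy)^{-1}\}$ if $0<x,y\le 1$, and $K(x,y)=0$ if $0\le x,y\le1$ and $xy=0$, where $\{\alpha\}=\alpha-\lfloor\alpha\rfloor$. Let $L^2([0,1])$ denote the space of real-valued Lebesgue measurable square-integrable functions on $[0,1]$, with $\langle f,g\rangle=\int_0^1 f(x)g(x)\,dx$ and $\|f\|=\langle f,f\rangle^{1/2}$. A function $\phi$ is an eigenfunction of $K$ (with eigenvalue $\lambda\in\mathbb R$) if $\phi\in L^2([0,1])$, $\|\phi\|>0$, and $\phi(x)=\lambda\int_0^1 K(x,y)\phi(y)\,dy$ for every $x\in[0,1]$. Let $\phi_1,\phi_2,\ldots$ be a maximal orthonormal system in $L^2([0,1])$ of eigenfunctions of $K$, $\phi_j$ having the nonzero real eigenvalue $\lambda_j$, numbered so that $0<|\lambda_1|\le|\lambda_2|\le\cdots$ and $\lambda_j\ge\lambda_{j+1}$ whenever $|\lambda_j|=|\lambda_{j+1}|$. At $x=1$, $\phi'(1)$ means the left-hand derivative. *)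

theory Defs
  imports "HOL-Analysis.Analysis"
begin

text \<open>The kernel K(x,y) = 1/2 - {1/(xy)} for 0 < x,y \<le> 1, and 0 when xy = 0.
  (Only its values on [0,1] x [0,1] matter.)\<close>
definition K :: "real \<Rightarrow> real \<Rightarrow> real" where
  "K x y = (if x * y = 0 then 0 else 1/2 - frac (1 / (x * y)))"

definition L2_01 :: "(real \<Rightarrow> real) \<Rightarrow> bool" where
  "L2_01 f \<longleftrightarrow> set_borel_measurable lebesgue {0..1} f
      \<and> set_integrable lebesgue {0..1} (\<lambda>x. (f x)\<^sup>2)"

definition inner01 :: "(real \<Rightarrow> real) \<Rightarrow> (real \<Rightarrow> real) \<Rightarrow> real" where
  "inner01 f g = (LINT x:{0..1}|lebesgue. f x * g x)"

definition norm01 :: "(real \<Rightarrow> real) \<Rightarrow> real" where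
  "norm01 f = sqrt (inner01 f f)"

definition eigenfunction :: "(real \<Rightarrow> real) \<Rightarrow> real \<Rightarrow> bool" where
  "eigenfunction phi lam \<longleftrightarrow> L2_01 phi \<and> norm01 phi > 0 \<and>
     (\<forall>x\<in>{0..1}. phi x = lam * (LINT y:{0..1}|lebesgue. K x y * phi y))"

definition max_ON_eigensystem :: "(nat \<Rightarrow> real \<Rightarrow> real) \<Rightarrow> (nat \<Rightarrow> real) \<Rightarrow> bool" where
  "max_ON_eigensystem phi lam \<longleftrightarrow>
     (\<forall>j\<ge>1. eigenfunction (phi j) (lam j) \<and> lam j \<noteq> 0)
   \<and> (\<forall>i\<ge>1. \<forall>j\<ge>1. inner01 (phi i) (phi j) = (if i = j then 1 else 0))
   \<and> \<not> (\<exists>psi mu. eigenfunction psi mu \<and> mu \<noteq> 0 \<and> (\<forall>j\<ge>1. inner01 psi (phi j) = 0))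
   \<and> 0 < \<bar>lam 1\<bar>
   \<and> (\<forall>j\<ge>1. \<bar>lam j\<bar> \<le> \<bar>lam (Suc j)\<bar>)
   \<and> (\<forall>j\<ge>1. \<bar>lam j\<bar> = \<bar>lam (Suc j)\<bar> \<longrightarrow> lam j \<ge> lam (Suc j))"

end

theory Submission
  imports Defs
begin

text \<open>Write \<open>w x = \<bar>f (a * x) - f x\<bar>\<close> for an eigenfunction \<open>f\<close>, and let \<open>M\<close> be the supremum of \<open>w\<close>;
  it suffices to show \<open>M = O ((1 - a) \<bar>lam\<bar>\<^sup>3 (ln \<bar>lam\<bar>)\<^sup>2)\<close> as \<open>a\<close> tends to 1 from below. The kernel
  depends on \<open>x * y\<close> only, so a change of variables gives
  \<open>w x \<le> \<bar>lam\<bar> / 2 * \<integral>w + O ((1 - a) lam\<^sup>2)\<close>. To bound \<open>\<integral>w\<close>, split the eigenvalue equation at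
  \<open>y = 1 / lam\<^sup>2\<close>: the part near 0 is again handled by the change of variables, and on the rest the
  \<open>L\<^sup>1\<close> norm of the increment of the kernel is \<open>O ((1 - a) ln \<bar>lam\<bar> / x)\<close>, whose integral over
  \<open>x \<ge> 1 / lam\<^sup>2\<close> contributes the second logarithm. The terms containing \<open>M\<close> add up to at most
  \<open>M / 2\<close> and are absorbed.\<close>

section \<open>Integrals over compact intervals\<close>

lemma set_integrable_Icc_bounded:
  fixes f :: "real \<Rightarrow> real"
  assumes [measurable]: "f \<in> borel_measurable borel"
    and "\<And>x. x \<in> {c..d} \<Longrightarrow> \<bar>f x\<bar> \<le> B"
  shows "set_integrable lborel {c..d} f"
  unfolding set_integrable_def
  by (rule integrableI_bounded_set_indicator[where B = B])
    (use assms in \<open>auto simp: emeasure_lborel_Icc_eq\<close>)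

lemma set_integral_Icc_const:
  assumes "c \<le> d"
  shows "(LINT x:{c..d}|lborel. B) = B * (d - c :: real)"
  using assms by (simp add: set_lebesgue_integral_def measure_def)

lemma set_integrable_Icc_const_lebesgue:
  "set_integrable lebesgue {c..d :: real} (\<lambda>_. B :: real)"
  unfolding set_integrable_def
  by (rule integrableI_bounded_set_indicator[where B = "\<bar>B\<bar>"]) (auto simp: emeasure_lborel_Icc_eq)

lemma abs_set_integral_Icc_le:
  fixes f :: "real \<Rightarrow> real"
  assumes [measurable]: "f \<in> borel_measurable borel"
    and bd: "\<And>x. x \<in> {c..d} \<Longrightarrow> \<bar>f x\<bar> \<le> B" and "c \<le> d"
  shows "\<bar>LINT x:{c..d}|lborel. f x\<bar> \<le> B * (d - c)"
proof -
  have "\<bar>LINT x:{c..d}|lborel. f x\<bar> \<le> (LINT x:{c..d}|lborel. \<bar>f x\<bar>)"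
    using set_integral_norm_bound[OF set_integrable_Icc_bounded[of f c d B]] bd by simp
  also have "\<dots> \<le> (LINT x:{c..d}|lborel. B)"
    by (intro set_integral_mono set_integrable_abs set_integrable_Icc_bounded[where B = B and f = f]
        set_integrable_Icc_bounded[where B = "\<bar>B\<bar>" and f = "\<lambda>_. B"] bd) auto
  also have "\<dots> = B * (d - c)"
    using \<open>c \<le> d\<close> by (rule set_integral_Icc_const)
  finally show ?thesis .
qed

lemma set_integral_Icc_split:
  fixes f :: "real \<Rightarrow> real"
  assumes "set_integrable lborel {c..e} f" "c \<le> d" "d \<le> e"
  shows "(LINT x:{c..e}|lborel. f x) = (LINT x:{c..d}|lborel. f x) + (LINT x:{d..e}|lborel. f x)"
proof -
  have "{c..e} = {c..d} \<union> {d..e}"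
    using assms by auto
  moreover have "(LINT x:{c..d} \<union> {d..e}|lborel. f x)
      = (LINT x:{c..d}|lborel. f x) + (LINT x:{d..e}|lborel. f x)"
  proof (rule set_integral_Un_AE)
    show "AE x in lborel. \<not> (x \<in> {c..d} \<and> x \<in> {d..e})"
      using AE_lborel_singleton[of d] by eventually_elim auto
  qed (use assms in \<open>auto intro!: set_integrable_subset[OF assms(1)]\<close>)
  ultimately show ?thesis by simp
qed

lemma set_integral_Icc_scale:
  fixes f :: "real \<Rightarrow> real"
  assumes "0 < a"
  shows "(LINT y:{a * c..a * d}|lborel. f y) = a * (LINT y:{c..d}|lborel. f (a * y))"
proof -
  have "indicator {a * c..a * d} (a * y) = (indicator {c..d} y :: real)" for y
    using assms by (auto simp: indicator_def)
  then show ?thesis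
    using lborel_integral_real_affine[of a "\<lambda>y. indicator {a * c..a * d} y *\<^sub>R f y" 0] assms
    by (simp add: set_lebesgue_integral_def)
qed

lemma set_integrable_inverse:
  assumes "0 < c"
  shows "set_integrable lborel {c..d} (\<lambda>y. s / y :: real)"
  by (rule set_integrable_Icc_bounded[where B = "\<bar>s\<bar> / c"])
    (use assms in \<open>auto intro!: frac_le\<close>)

lemma set_integral_inverse:
  assumes "0 < c" "c \<le> d"
  shows "(LINT y:{c..d}|lborel. s / y) = s * ln (d / c :: real)"
proof -
  have "(\<integral>y. (s / y) * indicator {c..d} y \<partial>lborel) = s * ln d - s * ln c"
    by (rule integral_FTC_Icc_real)
      (use assms in \<open>auto intro!: derivative_eq_intros continuous_intros\<close>)
  then show ?thesis
    using assms by (simp add: set_lebesgue_integral_def ln_div algebra_simps)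
qed

text \<open>Lets terms without a logarithm be absorbed into terms with one. The threshold 1/4
  matches a cut at 1 / lam^2 with |lam| at least 2.\<close>

lemma one_le_ln_inverse:
  fixes d :: real
  assumes "0 < d" "d \<le> 1 / 4"
  shows "1 \<le> ln (1 / d)"
proof -
  have "exp 1 \<le> (4 :: real)"
    using exp_le by simp
  also have "4 \<le> 1 / d"
    using assms by (simp add: field_simps)
  finally show ?thesis
    using assms by (subst ln_ge_iff) auto
qed

section \<open>The kernel and its increments under dilation\<close>

lemma K_abs_le: "\<bar>K x y\<bar> \<le> 1 / 2"
  using frac_ge_0[of "1 / (x * y)"] frac_lt_1[of "1 / (x * y)"]
  by (auto simp: K_def abs_if)

text \<open>A dilation moves from one variable to the other because only the product enters; this
  drives the change of variables in \<open>K_transform_increment_le\<close>.\<close>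

lemma K_mult_left: "K (a * x) y = K x (a * y)"
proof -
  have "a * x * y = x * (a * y)"
    by simp
  then show ?thesis
    by (simp only: K_def)
qed

lemma K_abs_mult_le:
  assumes "\<bar>u\<bar> \<le> B"
  shows "\<bar>K x y * u\<bar> \<le> B / 2"
  using mult_mono[OF K_abs_le[of x y] assms] by (simp add: abs_mult)

lemma K_measurable [measurable]: "K x \<in> borel_measurable borel"
  unfolding K_def frac_def by measurable

text \<open>Substituting a * y for y turns the integral of K x y * f y over [0, a * d] into a times
  that of K (a * x) y * f (a * y) over [0, d]. So the increment falls on f instead of the
  discontinuous kernel (\<open>T\<close>). The cost is the Jacobian defect (1 - a) *
  \<open>J\<close> and the leftover interval [a * d, d] (\<open>R\<close>), each at most (1 - a) * d
  * B / 2.\<close>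

lemma K_transform_increment_le:
  fixes f :: "real \<Rightarrow> real"
  assumes f [measurable]: "f \<in> borel_measurable borel" and bd: "\<And>x. \<bar>f x\<bar> \<le> B"
    and a: "0 < a" "a \<le> 1" and d: "0 \<le> d"
  shows "\<bar>LINT y:{0..d}|lborel. (K (a * x) y - K x y) * f y\<bar>
      \<le> (LINT y:{0..d}|lborel. \<bar>f (a * y) - f y\<bar>) / 2 + (1 - a) * d * B"
proof -
  have adle: "a * d \<le> d"
    using a d by (simp add: mult_left_le_one_le)
  have i: "set_integrable lborel {c..e} (\<lambda>y. K s y * f (t * y))" for c e s t
    by (rule set_integrable_Icc_bounded[where B = "B / 2"]) (measurable, rule K_abs_mult_le, rule bd)
  have i1: "set_integrable lborel {c..e} (\<lambda>y. K s y * f y)" for c e s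
    using i[of _ _ _ 1] by simp
  have db: "\<bar>f (a * y) - f y\<bar> \<le> 2 * B" for y
    using bd[of y] bd[of "a * y"] by linarith
  have i2: "set_integrable lborel {c..e} (\<lambda>y. K s y * (f (a * y) - f y))" for c e s
    by (rule set_integrable_Icc_bounded[where B = "2 * B / 2"])
      (measurable, rule K_abs_mult_le, rule db)
  have i3: "set_integrable lborel {c..e} (\<lambda>y. f (a * y) - f y)" for c e
    by (rule set_integrable_Icc_bounded[where B = "2 * B"]) (auto intro!: db)
  define T where "T = (LINT y:{0..d}|lborel. K (a * x) y * (f (a * y) - f y))"
  define J where "J = (LINT y:{0..d}|lborel. K (a * x) y * f (a * y))"
  define R where "R = (LINT y:{a * d..d}|lborel. K x y * f y)"
  have "(LINT y:{0..a * d}|lborel. K x y * f y) = a * (LINT y:{0..d}|lborel. K x (a * y) * f (a * y))"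
    using set_integral_Icc_scale[of a 0 d "\<lambda>y. K x y * f y"] a by simp
  also have "\<dots> = a * J"
    unfolding J_def K_mult_left ..
  finally have "(LINT y:{0..d}|lborel. K x y * f y) = a * J + R"
    using set_integral_Icc_split[OF i1, of 0 "a * d" d x] a d adle by (simp add: R_def)
  moreover have "(LINT y:{0..d}|lborel. K (a * x) y * f y) = J - T"
    unfolding J_def T_def set_integral_diff(2)[OF i i2, symmetric] by (simp add: algebra_simps)
  ultimately have eq: "(LINT y:{0..d}|lborel. (K (a * x) y - K x y) * f y) = (1 - a) * J - T - R"
    by (simp add: left_diff_distrib set_integral_diff(2)[OF i1 i1])
  have "\<bar>T\<bar> \<le> (LINT y:{0..d}|lborel. \<bar>K (a * x) y * (f (a * y) - f y)\<bar>)"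
    unfolding T_def using set_integral_norm_bound[OF i2] by simp
  also have "\<dots> \<le> (LINT y:{0..d}|lborel. \<bar>f (a * y) - f y\<bar> / 2)"
    by (intro set_integral_mono set_integrable_abs i2 set_integrable_divide i3)
      (use K_abs_mult_le in auto)
  finally have T: "\<bar>T\<bar> \<le> (LINT y:{0..d}|lborel. \<bar>f (a * y) - f y\<bar>) / 2"
    by simp
  have J: "\<bar>J\<bar> \<le> B / 2 * (d - 0)"
    unfolding J_def by (rule abs_set_integral_Icc_le) (measurable, rule K_abs_mult_le, rule bd, rule d)
  have R: "\<bar>R\<bar> \<le> B / 2 * (d - a * d)"
    unfolding R_def by (rule abs_set_integral_Icc_le) (measurable, rule K_abs_mult_le, rule bd, rule adle)
  have "\<bar>(1 - a) * J\<bar> \<le> (1 - a) * (B / 2 * (d - 0))"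
    using J a by (simp only: abs_mult) (intro mult_mono, auto)
  with T R have "\<bar>(1 - a) * J - T - R\<bar> \<le> (LINT y:{0..d}|lborel. \<bar>f (a * y) - f y\<bar>) / 2
      + ((1 - a) * (B / 2 * (d - 0)) + B / 2 * (d - a * d))"
    by linarith
  also have "(1 - a) * (B / 2 * (d - 0)) + B / 2 * (d - a * d) = (1 - a) * d * B"
    by (simp add: field_simps)
  finally show ?thesis
    unfolding eq .
qed

text \<open>The jumps of the kernel need no counting. The increment is a difference of two
  nonnegative terms: the growth of the floor \<open>F\<close> and the growth s / y of 1 / (x * y).
  Its absolute value is at most their sum, and the integral of F (a * y) - F y is computed by
  rescaling, after which most of it cancels.\<close>

lemma K_increment_integral_le:
  assumes a: "1 / 2 \<le> a" "a < 1" and d: "0 < d" "d \<le> 1 / 4" and x: "0 < x"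
  shows "(LINT y:{d..1}|lborel. \<bar>K (a * x) y - K x y\<bar>) \<le> 8 * ln (1 / d) * (1 - a) / x"
proof -
  define F where "F y = real_of_int \<lfloor>1 / (x * y)\<rfloor>" for y
  define G where "G = (LINT y:{a * d..1}|lborel. F y)"
  have [measurable]: "F \<in> borel_measurable borel"
    unfolding F_def by measurable
  have ad: "0 < a * d" "a * d \<le> d" "a * d \<le> 1" "d \<le> a" "a * d \<le> a" "0 < a"
    using a d by (auto simp: mult_left_le_one_le mult_le_one)
  have F0: "0 \<le> F y" if "0 < y" for y
    using that x by (simp add: F_def)
  have F1: "F y \<le> (1 / x) / y" if "0 < y" for y
    by (simp add: F_def)
  have Fi: "set_integrable lborel {c..e} F" if "0 < c" for c e
    using F0 F1 that
    by (intro set_integrable_bound[OF set_integrable_inverse[OF that, of e "1 / x"]])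
      (use x in \<open>auto simp: set_borel_measurable_def intro!: AE_I2\<close>)
  have Fiv: "(LINT y:{c..e}|lborel. F y) \<le> 1 / x * ln (e / c)" if "0 < c" "c \<le> e" for c e
    using set_integral_mono[OF Fi set_integrable_inverse[of c e "1 / x"]] that F1
      set_integral_inverse[of c e "1 / x"] by auto
  have Fn: "0 \<le> (LINT y:{c..e}|lborel. F y)" if "0 < c" for c e
    unfolding set_lebesgue_integral_def
    by (rule Bochner_Integration.integral_nonneg) (use that F0 in \<open>auto simp: indicator_def\<close>)
  have sc: "(LINT y:{a * d..a}|lborel. F y) = a * (LINT y:{d..1}|lborel. F (a * y))"
    using set_integral_Icc_scale[of a d 1 F] ad by simp
  have Fai: "set_integrable lborel {d..1} (\<lambda>y. F (a * y))"
    by (rule set_integrable_Icc_bounded[where B = "1 / x / (a * d)"])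
      (use F0 F1 ad d x in \<open>auto intro!: order_trans[OF F1] divide_left_mono mult_mono mult_pos_pos\<close>)
  define s where "s = 1 / (a * x) - 1 / x"
  have Kb: "\<bar>K (a * x) y - K x y\<bar> \<le> s / y + (F (a * y) - F y)" if y: "0 < y" for y
  proof -
    have eq: "K (a * x) y - K x y = (F (a * y) - F y) - s / y"
      using that x ad by (simp add: K_def frac_def F_def s_def field_simps)
    have "0 \<le> s / y"
      using y x a ad by (simp add: s_def field_simps)
    moreover have "0 \<le> F (a * y) - F y"
    proof -
      have "1 / (x * y) \<le> 1 / (x * (a * y))"
        using y x ad a by (intro divide_left_mono mult_left_mono) auto
      then show ?thesis
        unfolding F_def by (simp add: floor_mono)
    qed
    ultimately show ?thesis
      unfolding eq by linarith
  qed
  have "(LINT y:{d..1}|lborel. \<bar>K (a * x) y - K x y\<bar>)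
      \<le> (LINT y:{d..1}|lborel. s / y + (F (a * y) - F y))"
  proof (rule set_integral_mono)
    show "set_integrable lborel {d..1} (\<lambda>y. \<bar>K (a * x) y - K x y\<bar>)"
    proof (rule set_integrable_Icc_bounded[where B = 1])
      show "\<bar>\<bar>K (a * x) y - K x y\<bar>\<bar> \<le> 1" for y
        using K_abs_le[of "a * x" y] K_abs_le[of x y] by linarith
    qed measurable
    show "set_integrable lborel {d..1} (\<lambda>y. s / y + (F (a * y) - F y))"
      using d by (intro set_integral_add set_integral_diff set_integrable_inverse Fai Fi)
  qed (use Kb d in auto)
  also have "\<dots> = s * ln (1 / d) + ((LINT y:{a * d..a}|lborel. F y) / a - (LINT y:{d..1}|lborel. F y))"
    using d ad set_integral_inverse[of d 1 s]
    by (simp add: sc set_integral_add set_integral_diff set_integrable_inverse Fai Fi)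
  \<comment> \<open>Enlarging [a * d, a] to [a * d, 1] makes the two integrals of \<open>F\<close>
    overlap on all of [d, 1]. What survives is the multiple 1 / a - 1 of \<open>G\<close> and the
    integral over the short interval [a * d, d], both of order 1 - a.\<close>
  also have "\<dots> \<le> s * ln (1 / d) + (G / a - (LINT y:{d..1}|lborel. F y))"
  proof -
    have "(LINT y:{a * d..a}|lborel. F y) \<le> G"
      unfolding G_def
      using set_integral_Icc_split[OF Fi, of "a * d" a 1] Fn[of a 1] ad a by simp
    then show ?thesis
      using ad by (simp add: divide_right_mono)
  qed
  also have "G / a - (LINT y:{d..1}|lborel. F y) = (1 / a - 1) * G + (LINT y:{a * d..d}|lborel. F y)"
    using set_integral_Icc_split[OF Fi, of "a * d" d 1] ad d
    by (simp add: G_def algebra_simps add_divide_distrib)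
  also have "s * ln (1 / d) + \<dots>
      \<le> s * ln (1 / d) + ((1 / a - 1) * (1 / x * ln (1 / (a * d))) + 1 / x * ln (d / (a * d)))"
    unfolding G_def using ad(6) a
    by (intro add_left_mono add_mono mult_left_mono Fiv ad(1-3)) auto
  also have "\<dots> = ((1 / a - 1) * (ln (1 / d) + ln (1 / (a * d))) + ln (1 / a)) / x"
    using d x ad by (simp add: s_def field_simps)
  also have "\<dots> \<le> (8 * ln (1 / d) * (1 - a)) / x"
  proof (rule divide_right_mono)
    have r: "1 / a - 1 \<le> 2 * (1 - a)"
    proof -
      have "(1 - a) * (1 / a) \<le> (1 - a) * 2"
        using a ad by (intro mult_left_mono) (auto simp: field_simps)
      then show ?thesis
        using ad by (simp add: field_simps)
    qed
    have l: "ln (1 / a) \<le> 2 * (1 - a)"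
      using ln_le_minus_one[of "1 / a"] ad r by simp
    have L1: "1 \<le> ln (1 / d)"
      using d by (rule one_le_ln_inverse)
    \<comment> \<open>Since d <= a, the factor 1 / a is at most 1 / d. The two logarithms then add
      up to at most 3 ln (1 / d), giving 2 * 3 = 6; the term ln (1 / a) supplies the remaining 2 of
      the constant 8.\<close>
    have "ln (1 / (a * d)) \<le> ln (1 / d) + ln (1 / d)"
      using ad d by (simp add: ln_div ln_mult)
    then have "(1 / a - 1) * (ln (1 / d) + ln (1 / (a * d))) \<le> (2 * (1 - a)) * (3 * ln (1 / d))"
      using r L1 a ad d by (intro mult_mono) (auto simp: ln_ge_zero mult_le_one)
    moreover have "2 * (1 - a) \<le> 2 * (1 - a) * ln (1 / d)"
      using L1 a by (simp add: mult_left_le)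
    ultimately show "(1 / a - 1) * (ln (1 / d) + ln (1 / (a * d))) + ln (1 / a)
        \<le> 8 * ln (1 / d) * (1 - a)"
      using l by (simp add: algebra_simps)
  qed (use x in simp)
  finally show ?thesis .
qed

section \<open>The increment bound for bounded Borel solutions of the eigenvalue equation\<close>

lemma eigenfunction_increment_le:
  fixes f :: "real \<Rightarrow> real"
  assumes f [measurable]: "f \<in> borel_measurable borel" and bd: "\<And>x. \<bar>f x\<bar> \<le> \<bar>lam\<bar> / 2"
    and lam: "2 \<le> \<bar>lam\<bar>"
    and eig: "\<And>x. x \<in> {0..1} \<Longrightarrow> f x = lam * (LINT y:{0..1}|lborel. K x y * f y)"
    and a: "1 / 2 \<le> a" "a < 1" and x: "x \<in> {0..1}"
  shows "\<bar>f (a * x) - f x\<bar> \<le> 20 * (1 - a) * \<bar>lam\<bar> ^ 3 * (ln \<bar>lam\<bar>)\<^sup>2"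
proof -
  define l where "l = \<bar>lam\<bar>"
  \<comment> \<open>With this cut the summand l * M * d / 2 of \<open>Q\<close>, multiplied by the
    further factor l / 2 of the final estimate, is exactly M / 4, small enough to be
    absorbed.\<close>
  define d where "d = 1 / l\<^sup>2"
  define L where "L = ln (1 / d)"
  define w where "w x = \<bar>f (a * x) - f x\<bar>" for x
  define M where "M = (SUP x\<in>{0..1}. w x)"
  have l: "2 \<le> l"
    using lam by (simp add: l_def)
  have [measurable]: "w \<in> borel_measurable borel"
    unfolding w_def by measurable
  \<comment> \<open>A crude bound, uniform in x, that makes \<open>M\<close> a finite supremum; the
    absorption at the end depends on this.\<close>
  have wb: "w x \<le> l" for x
    using bd[of x] bd[of "a * x"] by (simp add: w_def l_def)
  have wM: "w x \<le> M" if "x \<in> {0..1}" for x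
    unfolding M_def using that wb by (intro cSUP_upper bdd_aboveI2[where M = l]) auto
  have w0: "0 \<le> w x" for x
    by (simp add: w_def)
  have wi: "set_integrable lborel {c..e} w" for c e
    by (rule set_integrable_Icc_bounded[where B = l]) (use wb w0 in auto)
  have "2 * 2 \<le> l * l"
    using l by (intro mult_mono) auto
  then have d: "0 < d" "d \<le> 1 / 4"
    using l by (auto simp: d_def power2_eq_square field_simps)
  have L: "L = 2 * ln l"
    using l by (simp add: L_def d_def ln_realpow)
  have L1: "1 \<le> L"
    unfolding L_def using d by (rule one_le_ln_inverse)
  have Ki: "set_integrable lborel {c..e} (\<lambda>y. K s y * f y)" for c e s
    by (rule set_integrable_Icc_bounded[where B = "l / 2 / 2"])
      (measurable, unfold l_def, rule K_abs_mult_le, rule bd)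
  have Di: "set_integrable lborel {c..e} (\<lambda>y. (K (a * s) y - K s y) * f y)" for c e s
    unfolding left_diff_distrib by (intro set_integral_diff Ki)
  have weq: "w s = l * \<bar>LINT y:{0..1}|lborel. (K (a * s) y - K s y) * f y\<bar>" if "s \<in> {0..1}" for s
  proof -
    have "a * s \<in> {0..1}"
      using that a by (auto simp: mult_le_one)
    then have "f (a * s) - f s = lam * (LINT y:{0..1}|lborel. (K (a * s) y - K s y) * f y)"
      using eig[of s] eig[of "a * s"] that
      by (simp add: left_diff_distrib right_diff_distrib set_integral_diff(2)[OF Ki Ki])
    then show ?thesis
      by (simp add: w_def l_def abs_mult)
  qed
  have near: "\<bar>LINT y:{0..e}|lborel. (K (a * s) y - K s y) * f y\<bar>
      \<le> (LINT y:{0..e}|lborel. w y) / 2 + (1 - a) * e * (l / 2)" if "0 \<le> e" for e s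
    unfolding w_def using K_transform_increment_le[of f "l / 2" a e s] a bd that
    by (simp add: l_def)
  have wd: "(LINT y:{0..d}|lborel. w y) \<le> M * d"
    using abs_set_integral_Icc_le[of w 0 d M] wM w0 d by auto
  \<comment> \<open>\<open>P / s\<close> is the far part l * (8 * L * (1 - a) / s) * (l / 2), the
    last factor being the bound on f. \<open>Q\<close> is the near part, with the integral of
    \<open>w\<close> over [0, d] replaced by M * d.\<close>
  define P where "P = 4 * l\<^sup>2 * L * (1 - a)"
  define Q where "Q = l * (M * d / 2 + (1 - a) * d * (l / 2))"
  have A: "w s \<le> P / s + Q" if s: "s \<in> {d..1}" for s
  proof -
    have s0: "0 < s" "s \<in> {0..1}"
      using s d by auto
    have "\<bar>LINT y:{d..1}|lborel. (K (a * s) y - K s y) * f y\<bar>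
        \<le> (LINT y:{d..1}|lborel. \<bar>(K (a * s) y - K s y) * f y\<bar>)"
      using set_integral_norm_bound[OF Di] by simp
    also have "\<dots> \<le> (LINT y:{d..1}|lborel. \<bar>K (a * s) y - K s y\<bar> * (l / 2))"
    proof (intro set_integral_mono set_integrable_abs Di set_integrable_mult_left)
      show "set_integrable lborel {d..1} (\<lambda>y. K (a * s) y - K s y)"
        by (intro set_integral_diff set_integrable_Icc_bounded[where B = "1 / 2"] K_abs_le) auto
    next
      show "\<bar>(K (a * s) y - K s y) * f y\<bar> \<le> \<bar>K (a * s) y - K s y\<bar> * (l / 2)" for y
        unfolding abs_mult l_def by (intro mult_left_mono bd) simp
    qed
    also have "\<dots> \<le> 8 * L * (1 - a) / s * (l / 2)"
      unfolding set_integral_mult_left L_def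
      using K_increment_integral_le[OF a d s0(1)] l by (intro mult_right_mono) auto
    finally have far: "\<bar>LINT y:{d..1}|lborel. (K (a * s) y - K s y) * f y\<bar>
        \<le> 8 * L * (1 - a) / s * (l / 2)" .
    have "\<bar>LINT y:{0..1}|lborel. (K (a * s) y - K s y) * f y\<bar>
        \<le> (M * d / 2 + (1 - a) * d * (l / 2)) + 8 * L * (1 - a) / s * (l / 2)"
      using set_integral_Icc_split[OF Di, of 0 d 1 s] near[of d s] wd far d by simp
    then have "w s \<le> l * ((M * d / 2 + (1 - a) * d * (l / 2)) + 8 * L * (1 - a) / s * (l / 2))"
      unfolding weq[OF s0(2)] using l by (intro mult_left_mono) auto
    then show ?thesis
      by (simp add: P_def Q_def algebra_simps power2_eq_square)
  qed
  have M0: "0 \<le> M"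
    using wM[of 0] w0[of 0] by simp
  have Q0: "0 \<le> Q"
    unfolding Q_def using M0 l a d by (intro mult_nonneg_nonneg add_nonneg_nonneg) auto
  have "(LINT y:{d..1}|lborel. w y) \<le> (LINT y:{d..1}|lborel. P / y + Q)"
    using d A by (intro set_integral_mono wi set_integral_add set_integrable_inverse
        set_integrable_Icc_bounded[where B = "\<bar>Q\<bar>"]) auto
  also have "\<dots> = P * L + Q * (1 - d)"
    using d set_integral_inverse[of d 1 P] set_integral_Icc_const[of d 1 Q]
    by (subst set_integral_add) (auto simp: L_def intro!: set_integrable_inverse
        set_integrable_Icc_bounded[where B = "\<bar>Q\<bar>"])
  also have "\<dots> \<le> P * L + Q"
    using Q0 d by (simp add: algebra_simps)
  finally have wI: "(LINT y:{0..1}|lborel. w y) \<le> M * d + (P * L + Q)"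
    using set_integral_Icc_split[OF wi, of 0 d 1] wd d by simp
  \<comment> \<open>Second use of the equation, now with the change of variables on all of [0, 1]:
    no pointwise factor 1 / s appears, only the integral of \<open>w\<close>, so the bound is
    uniform in s.\<close>
  have "w s \<le> l * ((M * d + (P * L + Q)) / 2 + (1 - a) * (l / 2))" if "s \<in> {0..1}" for s
  proof -
    have "\<bar>LINT y:{0..1}|lborel. (K (a * s) y - K s y) * f y\<bar>
        \<le> (LINT y:{0..1}|lborel. w y) / 2 + (1 - a) * (l / 2)"
      using near[of 1 s] by simp
    also have "\<dots> \<le> (M * d + (P * L + Q)) / 2 + (1 - a) * (l / 2)"
      by (intro add_right_mono divide_right_mono wI) simp
    finally show ?thesis
      unfolding weq[OF that] using l by (intro mult_left_mono) auto
  qed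
  then have "M \<le> l * ((M * d + (P * L + Q)) / 2 + (1 - a) * (l / 2))"
    unfolding M_def by (intro cSUP_least) auto
  \<comment> \<open>Here l * M * d / 2 = M / (2 * l), and l * Q / 2 = M / 4 + (1 - a) * l / 4. For l
    >= 2 the coefficient of \<open>M\<close> is at most 1 / 2.\<close>
  also have "\<dots> = M * (1 / (2 * l) + 1 / 4) + (1 - a) * (2 * l ^ 3 * L\<^sup>2 + l / 4 + l\<^sup>2 / 2)"
    using l by (simp add: P_def Q_def d_def field_simps power2_eq_square power3_eq_cube)
  also have "\<dots> \<le> M * (1 / 2) + (1 - a) * (5 / 2 * (l ^ 3 * L\<^sup>2))"
  proof (intro add_mono mult_left_mono M0)
    show "1 / (2 * l) + 1 / 4 \<le> 1 / 2"
      using l by (simp add: field_simps)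
    have "2 * l\<^sup>2 \<le> l ^ 3" "2 * l \<le> l\<^sup>2"
      using l by (auto simp: power2_eq_square power3_eq_cube)
    then have "l / 4 + l\<^sup>2 / 2 \<le> l ^ 3 / 2"
      using l by linarith
    also have "\<dots> \<le> l ^ 3 * L\<^sup>2 / 2"
      using l L1 by (simp add: one_le_power)
    finally show "2 * l ^ 3 * L\<^sup>2 + l / 4 + l\<^sup>2 / 2 \<le> 5 / 2 * (l ^ 3 * L\<^sup>2)"
      by (simp add: mult.commute)
  qed (use a in auto)
  finally have "M \<le> (1 - a) * (5 * (l ^ 3 * L\<^sup>2))"
    by simp
  \<comment> \<open>Absorbing M / 2 has doubled 5 / 2 to 5, and L = 2 * ln l contributes the factor
    4.\<close>
  also have "\<dots> = 20 * (1 - a) * l ^ 3 * (ln l)\<^sup>2"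
    unfolding L by (simp add: power_mult_distrib)
  finally show ?thesis
    using wM[OF x] unfolding w_def l_def by linarith
qed

section \<open>Normalised eigenfunctions: sup bound, eigenvalue bound, Borel measurability\<close>

lemma eigenfunction_abs_le:
  assumes "eigenfunction phi lam" "inner01 phi phi = 1" "x \<in> {0..1}"
  shows "\<bar>phi x\<bar> \<le> \<bar>lam\<bar> / 2"
proof -
  have m: "set_borel_measurable lebesgue {0..1} phi"
    and sq: "set_integrable lebesgue {0..1} (\<lambda>x. (phi x)\<^sup>2)"
    and eq: "phi x = lam * (LINT y:{0..1}|lebesgue. K x y * phi y)"
    using assms by (auto simp: eigenfunction_def L2_01_def)
  have I1: "(LINT y:{0..1}|lebesgue. (phi y)\<^sup>2) = 1"
    using assms by (simp add: inner01_def power2_eq_square)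
  have c: "set_integrable lebesgue {0..1} (\<lambda>_::real. 1 / 4 :: real)"
    by (rule set_integrable_Icc_const_lebesgue)
  have b: "set_integrable lebesgue {0..1} (\<lambda>y. 1 / 4 + (phi y)\<^sup>2 / 4)"
    by (intro set_integral_add c set_integrable_divide sq)
  have K: "K x \<in> borel_measurable lebesgue"
    by (rule measurable_completion) simp
  have mK: "set_borel_measurable lebesgue {0..1} (\<lambda>y. K x y * phi y)"
    using borel_measurable_times[OF K m[unfolded set_borel_measurable_def]]
    by (simp add: set_borel_measurable_def mult_ac)
  \<comment> \<open>This pointwise inequality replaces Cauchy-Schwarz: with unit norm, its right
    side integrates to 1/4 + 1/4, and it also gives integrability.\<close>
  have le: "\<bar>K x y * phi y\<bar> \<le> 1 / 4 + (phi y)\<^sup>2 / 4" for y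
  proof -
    have "0 \<le> (\<bar>phi y\<bar> - 1)\<^sup>2"
      by simp
    then have "\<bar>phi y\<bar> \<le> 1 / 2 + (phi y)\<^sup>2 / 2"
      by (simp add: power2_diff)
    then show ?thesis
      using K_abs_mult_le[of "phi y" "1 / 2 + (phi y)\<^sup>2 / 2" x y] by simp
  qed
  have i: "set_integrable lebesgue {0..1} (\<lambda>y. K x y * phi y)"
    by (rule set_integrable_bound[OF b mK]) (use le in \<open>auto intro!: AE_I2 order_trans[OF le]\<close>)
  have "\<bar>LINT y:{0..1}|lebesgue. K x y * phi y\<bar> \<le> (LINT y:{0..1}|lebesgue. \<bar>K x y * phi y\<bar>)"
    using set_integral_norm_bound[OF i] by simp
  also have "\<dots> \<le> (LINT y:{0..1}|lebesgue. 1 / 4 + (phi y)\<^sup>2 / 4)"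
    using le by (intro set_integral_mono set_integrable_abs i b)
  also have "\<dots> = 1 / 2"
    using I1 by (simp add: set_integral_add(2)[OF c set_integrable_divide[OF sq]])
      (simp add: set_lebesgue_integral_def measure_def)
  finally show ?thesis
    unfolding eq abs_mult using mult_left_mono[of _ "1 / 2" "\<bar>lam\<bar>"] by fastforce
qed

text \<open>Integrating the square of the sup bound over [0, 1] gives 1 <= (lam / 2)^2.\<close>

lemma eigenvalue_abs_ge:
  assumes "eigenfunction phi lam" "inner01 phi phi = 1"
  shows "2 \<le> \<bar>lam\<bar>"
proof -
  have sq: "set_integrable lebesgue {0..1} (\<lambda>x. (phi x)\<^sup>2)"
    using assms by (auto simp: eigenfunction_def L2_01_def)
  have "1 = (LINT y:{0..1}|lebesgue. (phi y)\<^sup>2)"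
    using assms by (simp add: inner01_def power2_eq_square)
  also have "\<dots> \<le> (LINT y::real:{0..1}|lebesgue. (\<bar>lam\<bar> / 2)\<^sup>2)"
  proof (intro set_integral_mono sq)
    show "set_integrable lebesgue {0..1} (\<lambda>_::real. (\<bar>lam\<bar> / 2)\<^sup>2)"
      by (rule set_integrable_Icc_const_lebesgue)
    show "(phi y)\<^sup>2 \<le> (\<bar>lam\<bar> / 2)\<^sup>2" if "y \<in> {0..1}" for y
      using eigenfunction_abs_le[OF assms that] by (simp add: abs_le_square_iff[symmetric])
  qed
  also have "\<dots> = (\<bar>lam\<bar> / 2)\<^sup>2"
    by (simp add: set_lebesgue_integral_def measure_def)
  finally show ?thesis
    using power2_le_imp_le[of 1 "\<bar>lam\<bar> / 2"] by simp
qed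

text \<open>A Lebesgue measurable function agrees almost everywhere with a Borel \<open>g\<close>.
  Exchanging the two under the integral changes nothing, so the equation expresses \<open>f\<close>
  at every point as the transform of \<open>g\<close>, and a parametric integral of a jointly Borel
  function is Borel. Extension by zero makes \<open>f\<close> a bounded function on the whole line
  when \<open>phi\<close> is normalised.\<close>

lemma eigenfunction_borel:
  assumes "eigenfunction phi lam"
  defines "f \<equiv> \<lambda>x. indicator {0..1} x * phi x"
  shows "f \<in> borel_measurable borel"
    and "\<And>x. x \<in> {0..1} \<Longrightarrow> f x = lam * (LINT y:{0..1}|lborel. K x y * f y)"
proof -
  have m: "f \<in> borel_measurable lebesgue"
    and eq: "\<And>x. x \<in> {0..1} \<Longrightarrow> phi x = lam * (LINT y:{0..1}|lebesgue. K x y * phi y)"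
    using assms by (auto simp: eigenfunction_def L2_01_def set_borel_measurable_def)
  obtain g where g [measurable]: "g \<in> borel_measurable borel" and ae: "AE y in lborel. f y = g y"
    using completion_ex_borel_measurable_real[OF m] by auto
  have K: "K x \<in> borel_measurable lebesgue" for x
    by (rule measurable_completion) simp
  have eqg: "f x = indicator {0..1} x * (lam * (LINT y:{0..1}|lborel. K x y * g y))" for x
  proof (cases "x \<in> {0..1}")
    case True
    have "(LINT y:{0..1}|lebesgue. K x y * phi y) = (LINT y|lebesgue. K x y * f y)"
      by (simp add: set_lebesgue_integral_def f_def mult_ac)
    also have "\<dots> = (LINT y|lebesgue. indicator {0..1} y * (K x y * g y))"
    proof (rule integral_cong_AE)
      show "AE y in lebesgue. K x y * f y = indicator {0..1} y * (K x y * g y)"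
        using AE_completion[OF ae]
      proof eventually_elim
        case (elim y)
        \<comment> \<open>\<open>f\<close> already vanishes off [0, 1], so the indicator can be
          inserted before \<open>g\<close> is substituted.\<close>
        have "f y = indicator {0..1} y * f y"
          by (simp add: f_def indicator_def)
        then show ?case
          by (simp add: elim)
      qed
    qed (auto intro!: borel_measurable_times K m measurable_completion[of g]
        measurable_completion[of "indicator {0..1}"])
    also have "\<dots> = (LINT y:{0..1}|lborel. K x y * g y)"
      unfolding set_lebesgue_integral_def by (subst integral_completion) auto
    finally show ?thesis
      using eq[OF True] True by (simp add: f_def)
  qed (simp add: f_def)
  have "(\<lambda>x. LINT y:{0..1}|lborel. K x y * g y) \<in> borel_measurable borel"
    unfolding set_lebesgue_integral_def K_def frac_def
    by (rule lborel.borel_measurable_lebesgue_integral) measurable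
  then show [measurable]: "f \<in> borel_measurable borel"
    unfolding eqg[abs_def] by measurable
  show "f x = lam * (LINT y:{0..1}|lborel. K x y * f y)" if "x \<in> {0..1}" for x
  proof -
    have "(LINT y:{0..1}|lborel. K x y * g y) = (LINT y:{0..1}|lborel. K x y * f y)"
      unfolding set_lebesgue_integral_def
      by (rule integral_cong_AE) (use ae in \<open>auto elim: eventually_mono\<close>)
    then show ?thesis
      using eqg[of x] that by simp
  qed
qed

section \<open>Passage from increments to the derivative\<close>

theorem theorem4p9:
  shows "\<exists>C>0. \<forall>phi lam. max_ON_eigensystem phi lam \<longrightarrow>
           (\<forall>j\<ge>1. \<forall>x\<in>{0<..1}. \<forall>D.
              (phi j has_real_derivative D) (at x within {0..1}) \<longrightarrow>
              \<bar>x * D\<bar> \<le> C * \<bar>lam j\<bar> ^ 3 * (ln \<bar>lam j\<bar>)\<^sup>2)"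
proof (intro exI[of _ 20] conjI allI impI ballI)
  fix phi lam x D and j :: nat
  assume sys: "max_ON_eigensystem phi lam" and j: "1 \<le> j" and x: "x \<in> {0<..1}"
    and D: "(phi j has_real_derivative D) (at x within {0..1})"
  have e: "eigenfunction (phi j) (lam j)" and n: "inner01 (phi j) (phi j) = 1"
    using sys j by (auto simp: max_ON_eigensystem_def)
  define R where "R = 20 * \<bar>lam j\<bar> ^ 3 * (ln \<bar>lam j\<bar>)\<^sup>2"
  define f where "f x = indicator {0..1} x * phi j x" for x
  have bd: "\<bar>f x\<bar> \<le> \<bar>lam j\<bar> / 2" for x
    using eigenfunction_abs_le[OF e n, of x] by (auto simp: f_def indicator_def)
  have inc: "\<bar>phi j (a * x) - phi j x\<bar> \<le> (1 - a) * R" if a: "1 / 2 \<le> a" "a < 1" for a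
  proof -
    have "a * x \<in> {0..1}"
      using a x by (auto simp: mult_le_one)
    then show ?thesis
      using eigenfunction_increment_le[OF eigenfunction_borel(1)[OF e, folded f_def] bd
          eigenvalue_abs_ge[OF e n] eigenfunction_borel(2)[OF e, folded f_def] a, of x] x
      by (simp add: f_def R_def algebra_simps)
  qed
  have "((\<lambda>y. (phi j y - phi j x) / (y - x)) \<longlongrightarrow> D) (at x within {0..1})"
    using D by (simp add: has_field_derivative_iff)
  \<comment> \<open>Approaching x along a * x with a tending to 1 from below stays inside [0, 1], so
    x = 1 with its left-hand derivative needs no separate case.\<close>
  moreover have "filterlim (\<lambda>a. a * x) (at x within {0..1}) (at_left 1)"
    unfolding filterlim_at
  proof
    have "eventually (\<lambda>a::real. a \<in> {1 / 2<..<1}) (at_left 1)"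
      by (rule eventually_at_leftI[of "1 / 2"]) auto
    then show "eventually (\<lambda>a. a * x \<in> {0..1} \<and> a * x \<noteq> x) (at_left 1)"
      by eventually_elim (use x in \<open>auto simp: mult_le_one\<close>)
    show "((\<lambda>a. a * x) \<longlongrightarrow> x) (at_left 1)"
      by (auto intro!: tendsto_eq_intros)
  qed
  ultimately have "((\<lambda>a. (phi j (a * x) - phi j x) / (a * x - x)) \<longlongrightarrow> D) (at_left 1)"
    by (rule filterlim_compose)
  then have "((\<lambda>a. \<bar>x * ((phi j (a * x) - phi j x) / (a * x - x))\<bar>) \<longlongrightarrow> \<bar>x * D\<bar>) (at_left 1)"
    by (intro tendsto_intros)
  moreover have "eventually (\<lambda>a. \<bar>x * ((phi j (a * x) - phi j x) / (a * x - x))\<bar> \<le> R) (at_left 1)"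
  proof -
    have "eventually (\<lambda>a::real. a \<in> {1 / 2<..<1}) (at_left 1)"
      by (rule eventually_at_leftI[of "1 / 2"]) auto
    then show ?thesis
    proof eventually_elim
      case (elim a)
      \<comment> \<open>The denominator is -x * (1 - a), so the factor x cancels; this is why x * D,
        and not D itself, is bounded uniformly.\<close>
      have "x * ((phi j (a * x) - phi j x) / (a * x - x)) = - (phi j (a * x) - phi j x) / (1 - a)"
        using x elim by (simp add: divide_simps) (simp add: algebra_simps)
      then have "\<bar>x * ((phi j (a * x) - phi j x) / (a * x - x))\<bar> = \<bar>phi j (a * x) - phi j x\<bar> / (1 - a)"
        using elim by simp
      also have "\<dots> \<le> R"
        using inc[of a] elim by (simp add: pos_divide_le_eq mult.commute)
      finally show ?case .
    qed
  qed
  ultimately show "\<bar>x * D\<bar> \<le> 20 * \<bar>lam j\<bar> ^ 3 * (ln \<bar>lam j\<bar>)\<^sup>2"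
    unfolding R_def[symmetric] by (rule tendsto_upperbound) simp
qed simp

end
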